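(* The mesh patterns $p_1=(12,\{(0,0),(0,1),(1,2),(2,1),(2,2)\})$ and $p_2=(12,\{(0,0),(0,1),(1,1),(1,2),(2,0)\})$ are equidistributed; that is, for all $n\ge 0$ and $k\ge 0$, the number of permutations in $S_n$ with exactly $k$ occurrences of $p_1$ equals the number of permutations in $S_n$ with exactly $k$ occurrences of $p_2$.
   Context: $S_n$ is the set of permutations $\pi=\pi_1\cdots\pi_n$ of $\{1,\dots,n\}$ ($S_0$ contains only the empty permutation). A mesh pattern $(12,R)$ consists of the permutation $12$ and a set $R\subseteq\{0,1,2\}\times\{0,1,2\}$ of shaded boxes. An occurrence of $(12,R)$ in $\pi\in S_n$ is a pair of positions $s<t$ with $\pi_s<\pi_t$ such that, putting $s_0=0,\ s_1=s,\ s_2=t,\ s_3=n+1$ and $v_0=0,\ v_1=\pi_s,\ v_2=\pi_t,\ v_3=n+1$, for every $(i,j)\in R$ there is no position $m$ with $s_i<m<s_{i+1}$ and $v_j<\pi_m<v_{j+1}$. *)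

theory Defs
  imports Main "HOL-Combinatorics.Permutations"
begin

text \<open>
  The set \<open>S\<^sub>n\<close> is rendered as the set of functions \<open>\<pi>\<close> with \<open>\<pi> permutes {1..n}\<close>, and the entry
  \<open>\<pi>\<^sub>m\<close> in position \<open>m \<in> {1..n}\<close> is \<open>\<pi> m\<close>. A mesh pattern \<open>(12, R)\<close> is represented by its set
  \<open>R \<subseteq> {0..2} \<times> {0..2}\<close> of shaded boxes.
\<close>

text \<open>
  The four grid lines \<open>0, a, b, n + 1\<close> bounding the three columns (for \<open>a, b\<close> positions) or the
  three rows (for \<open>a, b\<close> values). Only indices \<open>i \<le> 3\<close> are meaningful.
\<close>
definition grid_line :: "nat \<Rightarrow> nat \<Rightarrow> nat \<Rightarrow> nat \<Rightarrow> nat" where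
  "grid_line n a b i = [0, a, b, n + 1] ! i"

definition mesh12_occurrence :: "(nat \<times> nat) set \<Rightarrow> nat \<Rightarrow> (nat \<Rightarrow> nat) \<Rightarrow> nat \<Rightarrow> nat \<Rightarrow> bool" where
  "mesh12_occurrence R n \<pi> s t \<longleftrightarrow>
     s \<in> {1..n} \<and> t \<in> {1..n} \<and> s < t \<and> \<pi> s < \<pi> t \<and>
     (\<forall>(i, j) \<in> R. \<not> (\<exists>m \<in> {1..n}.
        grid_line n s t i < m \<and> m < grid_line n s t (i + 1) \<and>
        grid_line n (\<pi> s) (\<pi> t) j < \<pi> m \<and> \<pi> m < grid_line n (\<pi> s) (\<pi> t) (j + 1)))"

definition mesh12_count :: "(nat \<times> nat) set \<Rightarrow> nat \<Rightarrow> (nat \<Rightarrow> nat) \<Rightarrow> nat" where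
  "mesh12_count R n \<pi> = card {(s, t). mesh12_occurrence R n \<pi> s t}"

definition mesh12_equidistributed :: "(nat \<times> nat) set \<Rightarrow> (nat \<times> nat) set \<Rightarrow> bool" where
  "mesh12_equidistributed R R' \<longleftrightarrow>
     (\<forall>n k. card {\<pi>. \<pi> permutes {1..n} \<and> mesh12_count R n \<pi> = k}
          = card {\<pi>. \<pi> permutes {1..n} \<and> mesh12_count R' n \<pi> = k})"

end

theory Submission
  imports Defs
begin

text \<open>
  In an occurrence \<open>(s, t)\<close> of \<open>p\<^sub>1\<close> the entries left of \<open>s\<close> are exactly the \<open>s - 1\<close> largest
  values, so \<open>\<pi>\<close> is a skew sum \<open>\<mu> \<ominus> \<delta>\<close> with \<open>\<mu>\<close> of size \<open>p = s - 1\<close>, and \<open>\<delta>\<close> has an occurrence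
  starting at its first position. In an occurrence \<open>(s, t)\<close> of \<open>p\<^sub>2\<close> the entries strictly between
  the two positions are exactly the values below \<open>\<pi> s\<close>, so \<open>\<pi>\<close> arises from a permutation \<open>\<delta>\<close> that
  has an occurrence starting with the value 1 by plugging a permutation \<open>\<mu>\<close> of size \<open>p = \<pi> s - 1\<close>
  right behind and below that 1. In both cases \<open>p\<close> determines the occurrence, \<open>\<delta>\<close> and \<open>\<mu>\<close> are
  independent of each other, and the occurrences of \<open>\<pi>\<close> with a smaller index than \<open>p\<close> are
  precisely the occurrences of \<open>\<mu>\<close> (\<open>nested_marking_mark1\<close>, \<open>nested_marking_mark2\<close>).

  A permutation with more than \<open>j\<close> occurrences has exactly one occurrence that is preceded by \<open>j\<close>
  others. Cutting there shows that the number of permutations of size \<open>n\<close> with more than \<open>j\<close>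
  occurrences is the sum over \<open>p\<close> of \<open>b (n - p)\<close> times the number of permutations of size \<open>p\<close> with
  exactly \<open>j\<close> occurrences, where \<open>b m\<close> counts the possible \<open>\<delta>\<close> of size \<open>m\<close>. This recursion
  determines the whole distribution from \<open>b\<close> (\<open>nested_marking_equidistributed\<close>).

  It remains to compare the two sequences \<open>b\<close> (\<open>card_base_eq\<close>). For \<open>p\<^sub>1\<close> the words counted are
  \<open>a M z R\<close> with \<open>z\<close> the maximum and every entry of \<open>R\<close> below \<open>a\<close>; for \<open>p\<^sub>2\<close> they are \<open>L 1 b N\<close> with
  every entry of \<open>L\<close> above \<open>b\<close>. Complementing and reversing \<open>a M z R\<close> gives \<open>R' 1 M' a'\<close> with every
  entry of \<open>R'\<close> above \<open>a'\<close>, and moving \<open>a'\<close> to the place behind 1 gives a word of the second kind.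
\<close>

(* Keeps the bound of the intervals {1..n} a literal under simplification. *)
declare One_nat_def [simp del]

section \<open>Counting by nested occurrences\<close>

abbreviation perms :: "nat \<Rightarrow> (nat \<Rightarrow> nat) set" where
  "perms n \<equiv> {\<pi>. \<pi> permutes {1..n}}"

lemma finite_perms [simp]: "finite (perms n)"
  by (simp add: finite_permutations)

lemma bij_betw_rank:
  fixes A :: "nat set"
  assumes "finite A"
  shows "bij_betw (\<lambda>p. card {q \<in> A. q < p}) A {..<card A}"
proof -
  have less: "card {q \<in> A. q < p} < card {q \<in> A. q < p'}" if "p \<in> A" "p < p'" for p p'
    by (rule psubset_card_mono) (use assms that in auto)
  have inj: "inj_on (\<lambda>p. card {q \<in> A. q < p}) A"
    by (rule linorder_inj_onI) (use less in \<open>auto simp: less_le\<close>)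
  have "(\<lambda>p. card {q \<in> A. q < p}) ` A \<subseteq> {..<card A}"
    using assms by (auto intro!: psubset_card_mono)
  then have "(\<lambda>p. card {q \<in> A. q < p}) ` A = {..<card A}"
    by (rule card_subset_eq[rotated]) (use inj in \<open>simp_all add: card_image\<close>)
  with inj show ?thesis
    by (simp add: bij_betw_def)
qed

definition marks :: "(nat \<Rightarrow> nat \<Rightarrow> (nat \<Rightarrow> nat) \<Rightarrow> bool) \<Rightarrow> nat \<Rightarrow> (nat \<Rightarrow> nat) \<Rightarrow> nat set" where
  "marks P n \<pi> = {p. p < n \<and> P n p \<pi>}"

lemma finite_marks [simp]: "finite (marks P n \<pi>)"
  by (simp add: marks_def)

text \<open>
  \<open>P n p \<pi>\<close> is to be read as: the permutation \<open>\<pi>\<close> of size \<open>n\<close> has an occurrence with index \<open>p\<close>. The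
  axioms say that an occurrence with index \<open>p\<close> cuts \<open>\<pi>\<close> into an outer part, in which the occurrence
  has index 0, and an arbitrary inner part of size \<open>p\<close>, and that the inner part carries all
  occurrences of smaller index.
\<close>
locale nested_marking =
  fixes P :: "nat \<Rightarrow> nat \<Rightarrow> (nat \<Rightarrow> nat) \<Rightarrow> bool"
    and glue :: "nat \<Rightarrow> nat \<Rightarrow> (nat \<Rightarrow> nat) \<Rightarrow> (nat \<Rightarrow> nat) \<Rightarrow> (nat \<Rightarrow> nat)"
  assumes bij_glue:
      "bij_betw (\<lambda>(\<delta>, \<mu>). glue m p \<delta> \<mu>) ({\<delta> \<in> perms m. P m 0 \<delta>} \<times> perms p)
         {\<pi> \<in> perms (m + p). P (m + p) p \<pi>}"
    and lower_marks:
      "\<delta> \<in> perms m \<Longrightarrow> P m 0 \<delta> \<Longrightarrow> \<mu> \<in> perms p \<Longrightarrow> q < p \<Longrightarrow>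
         P (m + p) q (glue m p \<delta> \<mu>) \<longleftrightarrow> P p q \<mu>"
begin

lemma card_mark_of_rank:
  "card {\<pi> \<in> perms (m + p). P (m + p) p \<pi> \<and> card {q \<in> marks P (m + p) \<pi>. q < p} = j}
     = card {\<delta> \<in> perms m. P m 0 \<delta>} * card {\<mu> \<in> perms p. card (marks P p \<mu>) = j}"
proof -
  let ?g = "\<lambda>(\<delta>, \<mu>). glue m p \<delta> \<mu>"
  let ?D = "{\<delta> \<in> perms m. P m 0 \<delta>}"
  let ?X = "{\<pi> \<in> perms (m + p). P (m + p) p \<pi> \<and> card {q \<in> marks P (m + p) \<pi>. q < p} = j}"
  let ?Y = "?D \<times> {\<mu> \<in> perms p. card (marks P p \<mu>) = j}"
  have below: "{q \<in> marks P (m + p) (glue m p \<delta> \<mu>). q < p} = marks P p \<mu>"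
    if "\<delta> \<in> ?D" "\<mu> \<in> perms p" for \<delta> \<mu>
    using lower_marks[of \<delta> m \<mu> p] that by (auto simp: marks_def)
  have "?X = ?g ` ?Y"
  proof (intro set_eqI iffI)
    fix \<pi> assume "\<pi> \<in> ?X"
    moreover from this have "\<pi> \<in> ?g ` (?D \<times> perms p)"
      unfolding bij_betw_imp_surj_on[OF bij_glue[of m p]] by simp
    then obtain \<delta> \<mu> where "\<delta> \<in> ?D" "\<mu> \<in> perms p" "\<pi> = glue m p \<delta> \<mu>"
      by auto
    ultimately show "\<pi> \<in> ?g ` ?Y"
      using below[of \<delta> \<mu>] by force
  next
    fix \<pi> assume "\<pi> \<in> ?g ` ?Y"
    then obtain \<delta> \<mu> where *: "\<delta> \<in> ?D" "\<mu> \<in> perms p" "card (marks P p \<mu>) = j"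
      and \<pi>: "\<pi> = glue m p \<delta> \<mu>"
      by auto
    have "?g (\<delta>, \<mu>) \<in> {\<pi> \<in> perms (m + p). P (m + p) p \<pi>}"
      by (rule bij_betwE[OF bij_glue, rule_format]) (use * in simp)
    then show "\<pi> \<in> ?X"
      using below[OF *(1,2)] *(3) \<pi> by simp
  qed
  moreover have "inj_on ?g ?Y"
    by (rule inj_on_subset[OF bij_betw_imp_inj_on[OF bij_glue[of m p]]]) auto
  ultimately show ?thesis
    by (simp only: card_image card_cartesian_product)
qed

text \<open>
  Among more than \<open>j\<close> occurrences there is exactly one that has \<open>j\<close> occurrences of smaller index.
  The summands classify the permutations by the index \<open>p\<close> of that occurrence.
\<close>
lemma card_more_marks:
  "card {\<pi> \<in> perms n. j < card (marks P n \<pi>)}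
     = (\<Sum>p<n. card {\<delta> \<in> perms (n - p). P (n - p) 0 \<delta>}
               * card {\<mu> \<in> perms p. card (marks P p \<mu>) = j})"
proof -
  define X where
    "X p = {\<pi> \<in> perms n. P n p \<pi> \<and> card {q \<in> marks P n \<pi>. q < p} = j}" for p
  have "{\<pi> \<in> perms n. j < card (marks P n \<pi>)} = (\<Union>p<n. X p)"
  proof (intro set_eqI iffI)
    fix \<pi> assume "\<pi> \<in> {\<pi> \<in> perms n. j < card (marks P n \<pi>)}"
    then have "\<pi> \<in> perms n" "j \<in> {..<card (marks P n \<pi>)}" by auto
    moreover from this(2) obtain p where "p \<in> marks P n \<pi>" "j = card {q \<in> marks P n \<pi>. q < p}"
      unfolding bij_betw_imp_surj_on[OF bij_betw_rank[OF finite_marks, of P n \<pi>], symmetric]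
      by (rule imageE)
    ultimately show "\<pi> \<in> (\<Union>p<n. X p)" by (auto simp: X_def marks_def)
  next
    fix \<pi> assume "\<pi> \<in> (\<Union>p<n. X p)"
    then obtain p where p: "p \<in> marks P n \<pi>" "card {q \<in> marks P n \<pi>. q < p} = j" "\<pi> \<in> perms n"
      by (auto simp: X_def marks_def)
    then show "\<pi> \<in> {\<pi> \<in> perms n. j < card (marks P n \<pi>)}"
      using bij_betwE[OF bij_betw_rank[of "marks P n \<pi>"]] by auto
  qed
  moreover have "X p \<inter> X p' = {}" if "p < n" "p' < n" "p \<noteq> p'" for p p'
  proof -
    have False if "\<pi> \<in> X p" "\<pi> \<in> X p'" for \<pi>
      using inj_onD[OF bij_betw_imp_inj_on[OF bij_betw_rank[of "marks P n \<pi>"]], of p p'] that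
        \<open>p < n\<close> \<open>p' < n\<close> \<open>p \<noteq> p'\<close> by (auto simp: X_def marks_def)
    then show ?thesis by auto
  qed
  moreover have "finite (X p)" for p
    by (rule finite_subset[OF _ finite_perms]) (auto simp: X_def)
  ultimately have "card {\<pi> \<in> perms n. j < card (marks P n \<pi>)} = (\<Sum>p<n. card (X p))"
    by (simp add: card_UN_disjoint)
  also have "\<dots> = (\<Sum>p<n. card {\<delta> \<in> perms (n - p). P (n - p) 0 \<delta>}
               * card {\<mu> \<in> perms p. card (marks P p \<mu>) = j})"
  proof (rule sum.cong[OF refl])
    fix p assume "p \<in> {..<n}"
    then show "card (X p) = card {\<delta> \<in> perms (n - p). P (n - p) 0 \<delta>}
               * card {\<mu> \<in> perms p. card (marks P p \<mu>) = j}"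
      using card_mark_of_rank[of "n - p" p j] by (simp add: X_def)
  qed
  finally show ?thesis .
qed

end

text \<open>
  By induction on the size: only sizes \<open>p < n\<close> enter the right-hand side of
  \<open>card_more_marks\<close>, so the numbers of permutations with more than \<open>j\<close> occurrences agree for all
  \<open>j\<close>, and the numbers with exactly \<open>k\<close> are differences of these.
\<close>
lemma nested_marking_equidistributed:
  assumes P: "nested_marking P g" and Q: "nested_marking Q h"
    and base: "\<And>m. card {\<delta> \<in> perms m. P m 0 \<delta>} = card {\<delta> \<in> perms m. Q m 0 \<delta>}"
  shows "card {\<pi> \<in> perms n. card (marks P n \<pi>) = k} = card {\<pi> \<in> perms n. card (marks Q n \<pi>) = k}"
proof (induction n arbitrary: k rule: less_induct)
  case (less n)
  have more: "card {\<pi> \<in> perms n. j < card (marks P n \<pi>)} = card {\<pi> \<in> perms n. j < card (marks Q n \<pi>)}" for j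
    unfolding nested_marking.card_more_marks[OF P] nested_marking.card_more_marks[OF Q]
  proof (rule sum.cong[OF refl])
    fix p assume "p \<in> {..<n}"
    then show "card {\<delta> \<in> perms (n - p). P (n - p) 0 \<delta>} * card {\<mu> \<in> perms p. card (marks P p \<mu>) = j}
      = card {\<delta> \<in> perms (n - p). Q (n - p) 0 \<delta>} * card {\<mu> \<in> perms p. card (marks Q p \<mu>) = j}"
      unfolding base using less.IH[of p j] by (simp only: lessThan_iff)
  qed
  let ?gt = "\<lambda>A j. {\<pi> \<in> perms n. j < card (marks A n \<pi>)}"
  have fin: "finite (?gt A j)" for A j
    by (rule finite_subset[OF _ finite_perms[of n]]) blast
  have exact0: "card {\<pi> \<in> perms n. card (marks A n \<pi>) = 0} = card (perms n) - card (?gt A 0)" for A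
  proof -
    have "{\<pi> \<in> perms n. card (marks A n \<pi>) = 0} = perms n - ?gt A 0"
      by auto
    then show ?thesis using card_Diff_subset[OF fin[where A = A and j = 0], of "perms n"] by force
  qed
  have exactS: "card {\<pi> \<in> perms n. card (marks A n \<pi>) = Suc j} = card (?gt A j) - card (?gt A (Suc j))"
    for A j
  proof -
    have "{\<pi> \<in> perms n. card (marks A n \<pi>) = Suc j} = ?gt A j - ?gt A (Suc j)"
      by auto
    moreover have "?gt A (Suc j) \<subseteq> ?gt A j"
      by auto
    ultimately show ?thesis using card_Diff_subset[OF fin[where A = A and j = "Suc j"], of "?gt A j"] by metis
  qed
  show ?case
  proof (cases k)
    case 0
    show ?thesis unfolding 0 exact0 more by (rule refl)
  next
    case (Suc j)
    show ?thesis unfolding Suc exactS more by (rule refl)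
  qed
qed

section \<open>Plugging a permutation into another\<close>

text \<open>
  The increasing map of the naturals onto the complement of \<open>{s + 1..s + p}\<close>, and a left inverse.
\<close>
definition skip :: "nat \<Rightarrow> nat \<Rightarrow> nat \<Rightarrow> nat" where
  "skip s p i = (if i \<le> s then i else i + p)"

definition unskip :: "nat \<Rightarrow> nat \<Rightarrow> nat \<Rightarrow> nat" where
  "unskip s p i = (if i \<le> s then i else i - p)"

lemma unskip_skip [simp]: "unskip s p (skip s p i) = i"
  by (simp add: skip_def unskip_def)

lemma skip_unskip: "i \<notin> {s + 1..s + p} \<Longrightarrow> skip s p (unskip s p i) = i"
  by (auto simp: skip_def unskip_def)

text \<open>
  In the diagram of \<open>\<delta>\<close>, open a gap of \<open>p\<close> columns behind column \<open>s\<close> and a gap of \<open>p\<close> rows above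
  row \<open>v\<close>, and put the diagram of \<open>\<mu>\<close> where they cross. The skew sum is the case of \<open>s = 0\<close> with
  \<open>v\<close> the size of \<open>\<delta>\<close>.
\<close>
definition plug :: "nat \<Rightarrow> nat \<Rightarrow> nat \<Rightarrow> (nat \<Rightarrow> nat) \<Rightarrow> (nat \<Rightarrow> nat) \<Rightarrow> nat \<Rightarrow> nat" where
  "plug s v p \<delta> \<mu> i =
     (if i \<in> {s + 1..s + p} then v + \<mu> (i - s) else skip v p (\<delta> (unskip s p i)))"

lemma plug_skip [simp]: "plug s v p \<delta> \<mu> (skip s p i) = skip v p (\<delta> i)"
  by (auto simp: plug_def skip_def unskip_def)

lemma plug_block: "i \<in> {1..p} \<Longrightarrow> plug s v p \<delta> \<mu> (s + i) = v + \<mu> i"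
  by (auto simp: plug_def)

lemma permutes_range:
  assumes "\<pi> permutes {1..n::nat}"
  shows "1 \<le> i \<Longrightarrow> i \<le> n \<Longrightarrow> 1 \<le> \<pi> i" and "i \<le> n \<Longrightarrow> \<pi> i \<le> n"
proof -
  have "1 \<le> \<pi> i \<and> \<pi> i \<le> n" if "1 \<le> i" "i \<le> n"
    using permutes_in_image[OF assms, of i] that by auto
  moreover have "\<pi> 0 = 0" using permutes_not_in[OF assms, of 0] by simp
  ultimately show "1 \<le> i \<Longrightarrow> i \<le> n \<Longrightarrow> 1 \<le> \<pi> i" and "i \<le> n \<Longrightarrow> \<pi> i \<le> n"
    by (cases "i = 0", auto)+
qed

lemma permutes_interval_iff:
  fixes \<pi> :: "nat \<Rightarrow> nat"
  shows "\<pi> permutes {1..n} \<longleftrightarrow> inj \<pi> \<and> (\<forall>i. i \<notin> {1..n} \<longrightarrow> \<pi> i = i)"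
proof
  assume "\<pi> permutes {1..n}"
  then show "inj \<pi> \<and> (\<forall>i. i \<notin> {1..n} \<longrightarrow> \<pi> i = i)"
    using permutes_inj permutes_not_in by metis
next
  assume *: "inj \<pi> \<and> (\<forall>i. i \<notin> {1..n} \<longrightarrow> \<pi> i = i)"
  then have "\<pi> ` {1..n} \<subseteq> {1..n}"
    by (metis image_subsetI injD)
  moreover from * have "inj_on \<pi> {1..n}"
    by (auto intro: inj_on_subset)
  ultimately have "bij_betw \<pi> {1..n} {1..n}"
    by (simp add: bij_betw_def endo_inj_surj)
  with * show "\<pi> permutes {1..n}"
    by (auto intro: bij_imp_permutes)
qed

lemma plug_permutes:
  assumes \<delta>: "\<delta> permutes {1..m}" and \<mu>: "\<mu> permutes {1..p}" and "s \<le> m" "v \<le> m"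
  shows "plug s v p \<delta> \<mu> permutes {1..m + p}"
proof -
  have block: "plug s v p \<delta> \<mu> i \<in> {v + 1..v + p}" if "i \<in> {s + 1..s + p}" for i
    using permutes_range[OF \<mu>, of "i - s"] that by (auto simp: plug_def)
  have outer: "plug s v p \<delta> \<mu> i \<notin> {v + 1..v + p}" if "i \<notin> {s + 1..s + p}" for i
    using that by (auto simp: plug_def skip_def)
  have "inj (plug s v p \<delta> \<mu>)"
  proof (rule injI)
    fix i j assume eq: "plug s v p \<delta> \<mu> i = plug s v p \<delta> \<mu> j"
    show "i = j"
    proof (cases "i \<in> {s + 1..s + p}")
      case True
      with eq block[of i] outer[of j] have "j \<in> {s + 1..s + p}" by auto
      with True eq have "\<mu> (i - s) = \<mu> (j - s)" by (simp add: plug_def)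
      with permutes_inj[OF \<mu>] have "i - s = j - s" by (simp add: inj_eq)
      with True \<open>j \<in> {s + 1..s + p}\<close> show ?thesis by auto
    next
      case False
      with eq block[of j] outer[of i] have "j \<notin> {s + 1..s + p}" by auto
      with False eq have "skip v p (\<delta> (unskip s p i)) = skip v p (\<delta> (unskip s p j))"
        unfolding plug_def by (simp only: if_False)
      then have "unskip s p i = unskip s p j"
        using permutes_inj[OF \<delta>] by (metis unskip_skip inj_eq)
      with False \<open>j \<notin> {s + 1..s + p}\<close> show ?thesis by (metis skip_unskip)
    qed
  qed
  moreover have "plug s v p \<delta> \<mu> i = i" if "i \<notin> {1..m + p}" for i
  proof -
    from that have "unskip s p i \<notin> {1..m}" "i \<notin> {s + 1..s + p}"
      using assms(3) by (auto simp: unskip_def)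
    with that show ?thesis
      using permutes_not_in[OF \<delta>] assms(3,4)
      by (auto simp: plug_def skip_def unskip_def)
  qed
  ultimately show ?thesis by (simp add: permutes_interval_iff)
qed

lemma plug_inject:
  assumes "plug s v p \<delta> \<mu> = plug s v p \<delta>' \<mu>'"
    and "\<mu> permutes {1..p}" "\<mu>' permutes {1..p}"
  shows "\<delta> = \<delta>'" "\<mu> = \<mu>'"
proof -
  show "\<delta> = \<delta>'"
  proof
    fix i
    have "skip v p (\<delta> i) = skip v p (\<delta>' i)"
      using fun_cong[OF assms(1), of "skip s p i"] by simp
    then show "\<delta> i = \<delta>' i" by (metis unskip_skip)
  qed
  show "\<mu> = \<mu>'"
  proof
    fix i
    show "\<mu> i = \<mu>' i"
    proof (cases "i \<in> {1..p}")
      case True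
      then show ?thesis using fun_cong[OF assms(1), of "s + i"] by (simp add: plug_block)
    next
      case False
      then show ?thesis using assms(2,3) by (metis permutes_not_in)
    qed
  qed
qed

lemma plug_exists:
  assumes \<pi>: "\<pi> permutes {1..m + p}" and "s \<le> m" "v \<le> m"
    and block: "\<pi> ` {s + 1..s + p} = {v + 1..v + p}"
  obtains \<delta> \<mu> where "\<delta> permutes {1..m}" "\<mu> permutes {1..p}" "\<pi> = plug s v p \<delta> \<mu>"
proof
  define \<delta> where "\<delta> i = unskip v p (\<pi> (skip s p i))" for i
  define \<mu> where "\<mu> i = (if i \<in> {1..p} then \<pi> (s + i) - v else i)" for i
  note inj = permutes_inj[OF \<pi>]
  have mem: "\<pi> i \<in> {v + 1..v + p} \<longleftrightarrow> i \<in> {s + 1..s + p}" for i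
    using inj block by (metis inj_image_mem_iff)
  have out: "skip s p i \<notin> {s + 1..s + p}" for i
    by (auto simp: skip_def)
  have \<delta>: "skip v p (\<delta> i) = \<pi> (skip s p i)" for i
    using mem[of "skip s p i"] out[of i] unfolding \<delta>_def by (simp add: skip_unskip)
  have "inj \<delta>"
    using \<delta> inj by (metis injI injD unskip_skip)
  moreover have "\<delta> i = i" if "i \<notin> {1..m}" for i
  proof -
    have "skip s p i \<notin> {1..m + p}" using that \<open>s \<le> m\<close> by (auto simp: skip_def)
    then have "\<pi> (skip s p i) = skip s p i" using permutes_not_in[OF \<pi>] by blast
    then show ?thesis using that \<open>s \<le> m\<close> \<open>v \<le> m\<close> by (auto simp: \<delta>_def skip_def unskip_def)
  qed
  ultimately show "\<delta> permutes {1..m}" by (simp add: permutes_interval_iff)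
  have \<mu>: "v + \<mu> i = \<pi> (s + i)" "\<mu> i \<in> {1..p}" if "i \<in> {1..p}" for i
    using mem[of "s + i"] that by (auto simp: \<mu>_def)
  have "inj \<mu>"
  proof (rule injI)
    fix i j assume eq: "\<mu> i = \<mu> j"
    show "i = j"
    proof (cases "i \<in> {1..p}")
      case True
      then have "j \<in> {1..p}" using eq \<mu>(2)[of i] by (auto simp: \<mu>_def split: if_splits)
      with True eq \<mu>(1) have "\<pi> (s + i) = \<pi> (s + j)" by metis
      then show ?thesis using inj by (simp add: inj_eq)
    next
      case False
      then show ?thesis using eq \<mu>(2)[of j] by (auto simp: \<mu>_def split: if_splits)
    qed
  qed
  then show "\<mu> permutes {1..p}" by (simp add: permutes_interval_iff \<mu>_def)
  show "\<pi> = plug s v p \<delta> \<mu>"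
  proof
    fix i
    show "\<pi> i = plug s v p \<delta> \<mu> i"
    proof (cases "i \<in> {s + 1..s + p}")
      case True
      then have mem: "i - s \<in> {1..p}" and eq: "s + (i - s) = i" by auto
      show ?thesis using \<mu>(1)[OF mem] True unfolding plug_def eq by (simp only: if_True)
    next
      case False
      then show ?thesis using \<delta>[of "unskip s p i"]
        unfolding plug_def if_not_P[OF False] by (simp add: skip_unskip)
    qed
  qed
qed


section \<open>The two patterns\<close>

text \<open>
  \<open>occ1\<close> and \<open>occ2\<close> are the occurrences of \<open>p\<^sub>1\<close> and \<open>p\<^sub>2\<close> in terms of comparisons. In each of the six
  columns concerned the unshaded boxes form an initial or a final segment of the rows, so that
  the shading amounts to one inequality per column. For \<open>p\<^sub>1\<close> row 2 remains in column 0, rows 0 and 1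
  in column 1, and row 0 in column 2; for \<open>p\<^sub>2\<close> these are row 2, row 0, and rows 1 and 2.
\<close>
definition occ1 :: "nat \<Rightarrow> (nat \<Rightarrow> nat) \<Rightarrow> nat \<Rightarrow> nat \<Rightarrow> bool" where
  "occ1 n \<pi> s t \<longleftrightarrow> 1 \<le> s \<and> s < t \<and> t \<le> n \<and> \<pi> s < \<pi> t \<and>
     (\<forall>i. 1 \<le> i \<and> i < s \<longrightarrow> \<pi> t < \<pi> i) \<and>
     (\<forall>i. s < i \<and> i < t \<longrightarrow> \<pi> i < \<pi> t) \<and>
     (\<forall>i. t < i \<and> i \<le> n \<longrightarrow> \<pi> i < \<pi> s)"

definition occ2 :: "nat \<Rightarrow> (nat \<Rightarrow> nat) \<Rightarrow> nat \<Rightarrow> nat \<Rightarrow> bool" where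
  "occ2 n \<pi> s t \<longleftrightarrow> 1 \<le> s \<and> s < t \<and> t \<le> n \<and> \<pi> s < \<pi> t \<and>
     (\<forall>i. 1 \<le> i \<and> i < s \<longrightarrow> \<pi> t < \<pi> i) \<and>
     (\<forall>i. s < i \<and> i < t \<longrightarrow> \<pi> i < \<pi> s) \<and>
     (\<forall>i. t < i \<and> i \<le> n \<longrightarrow> \<pi> s < \<pi> i)"

lemma grid_line_simps:
  "grid_line n a b 0 = 0" "grid_line n a b 1 = a" "grid_line n a b 2 = b" "grid_line n a b 3 = n + 1"
  by (simp_all add: grid_line_def One_nat_def)

lemma mesh12_occurrence_iff_occ1:
  assumes "\<pi> permutes {1..n}"
  shows "mesh12_occurrence {(0, 0), (0, 1), (1, 2), (2, 1), (2, 2)} n \<pi> s t \<longleftrightarrow> occ1 n \<pi> s t"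
proof (cases "1 \<le> s \<and> s < t \<and> t \<le> n \<and> \<pi> s < \<pi> t")
  case True
  define a b where "a = \<pi> s" and "b = \<pi> t"
  define A where "A m x \<longleftrightarrow>
      \<not> (0 < m \<and> m < s \<and> 0 < x \<and> x < a) \<and>
      \<not> (0 < m \<and> m < s \<and> a < x \<and> x < b) \<and>
      \<not> (s < m \<and> m < t \<and> b < x \<and> x < n + 1) \<and>
      \<not> (t < m \<and> m < n + 1 \<and> a < x \<and> x < b) \<and>
      \<not> (t < m \<and> m < n + 1 \<and> b < x \<and> x < n + 1)" for m x
  define C where "C m x \<longleftrightarrow> (m < s \<longrightarrow> b < x) \<and> (s < m \<and> m < t \<longrightarrow> x < b)
      \<and> (t < m \<longrightarrow> x < a)" for m x
  have "A m x \<longleftrightarrow> C m x"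
    if x: "0 < x" "x < n + 1" and eq: "x = a \<longleftrightarrow> m = s" "x = b \<longleftrightarrow> m = t" and m: "1 \<le> m" "m \<le> n" for m x
  proof -
    have *: "a < b" "s < t" "0 < m" "m < n + 1" using True m by (auto simp: a_def b_def)
    consider "m < s" "x \<noteq> a" "x \<noteq> b" | "m = s" "x = a"
      | "s < m" "m < t" "x \<noteq> a" "x \<noteq> b" | "m = t" "x = b" | "t < m" "x \<noteq> a" "x \<noteq> b"
      using eq *(2) by (metis less_trans nat_neq_iff)
    then show ?thesis
      using x * unfolding A_def C_def by cases (simp_all, linarith+)
  qed
  then have "A m (\<pi> m) \<longleftrightarrow> C m (\<pi> m)" if "m \<in> {1..n}" for m
    using permutes_range[OF assms, of m] permutes_inj[OF assms] that
    by (simp add: a_def b_def inj_eq)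
  moreover have "mesh12_occurrence {(0, 0), (0, 1), (1, 2), (2, 1), (2, 2)} n \<pi> s t \<longleftrightarrow>
      (\<forall>m\<in>{1..n}. A m (\<pi> m))"
    using True unfolding mesh12_occurrence_def A_def a_def b_def by (simp add: grid_line_simps ball_conj_distrib) auto
  moreover have "occ1 n \<pi> s t \<longleftrightarrow> (\<forall>m\<in>{1..n}. C m (\<pi> m))"
    using True unfolding occ1_def C_def a_def b_def by auto
  ultimately show ?thesis by simp
qed (auto simp: mesh12_occurrence_def occ1_def)

lemma mesh12_occurrence_iff_occ2:
  assumes "\<pi> permutes {1..n}"
  shows "mesh12_occurrence {(0, 0), (0, 1), (1, 1), (1, 2), (2, 0)} n \<pi> s t \<longleftrightarrow> occ2 n \<pi> s t"
proof (cases "1 \<le> s \<and> s < t \<and> t \<le> n \<and> \<pi> s < \<pi> t")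
  case True
  define a b where "a = \<pi> s" and "b = \<pi> t"
  define A where "A m x \<longleftrightarrow>
      \<not> (0 < m \<and> m < s \<and> 0 < x \<and> x < a) \<and>
      \<not> (0 < m \<and> m < s \<and> a < x \<and> x < b) \<and>
      \<not> (s < m \<and> m < t \<and> a < x \<and> x < b) \<and>
      \<not> (s < m \<and> m < t \<and> b < x \<and> x < n + 1) \<and>
      \<not> (t < m \<and> m < n + 1 \<and> 0 < x \<and> x < a)" for m x
  define C where "C m x \<longleftrightarrow> (m < s \<longrightarrow> b < x) \<and> (s < m \<and> m < t \<longrightarrow> x < a)
      \<and> (t < m \<longrightarrow> a < x)" for m x
  have "A m x \<longleftrightarrow> C m x"
    if x: "0 < x" "x < n + 1" and eq: "x = a \<longleftrightarrow> m = s" "x = b \<longleftrightarrow> m = t" and m: "1 \<le> m" "m \<le> n" for m x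
  proof -
    have *: "a < b" "s < t" "0 < m" "m < n + 1" using True m by (auto simp: a_def b_def)
    consider "m < s" "x \<noteq> a" "x \<noteq> b" | "m = s" "x = a"
      | "s < m" "m < t" "x \<noteq> a" "x \<noteq> b" | "m = t" "x = b" | "t < m" "x \<noteq> a" "x \<noteq> b"
      using eq *(2) by (metis less_trans nat_neq_iff)
    then show ?thesis
      using x * unfolding A_def C_def by cases (simp_all, linarith+)
  qed
  then have "A m (\<pi> m) \<longleftrightarrow> C m (\<pi> m)" if "m \<in> {1..n}" for m
    using permutes_range[OF assms, of m] permutes_inj[OF assms] that
    by (simp add: a_def b_def inj_eq)
  moreover have "mesh12_occurrence {(0, 0), (0, 1), (1, 1), (1, 2), (2, 0)} n \<pi> s t \<longleftrightarrow>
      (\<forall>m\<in>{1..n}. A m (\<pi> m))"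
    using True unfolding mesh12_occurrence_def A_def a_def b_def by (simp add: grid_line_simps ball_conj_distrib) auto
  moreover have "occ2 n \<pi> s t \<longleftrightarrow> (\<forall>m\<in>{1..n}. C m (\<pi> m))"
    using True unfolding occ2_def C_def a_def b_def by auto
  ultimately show ?thesis by simp
qed (auto simp: mesh12_occurrence_def occ2_def)

text \<open>
  The index of an occurrence is the size of the part that is cut off: the entries in front of the
  occurrence for \<open>p\<^sub>1\<close>, the values below it for \<open>p\<^sub>2\<close>.
\<close>
definition mark1 :: "nat \<Rightarrow> nat \<Rightarrow> (nat \<Rightarrow> nat) \<Rightarrow> bool" where
  "mark1 n p \<pi> \<longleftrightarrow> (\<exists>t. occ1 n \<pi> (p + 1) t)"

definition mark2 :: "nat \<Rightarrow> nat \<Rightarrow> (nat \<Rightarrow> nat) \<Rightarrow> bool" where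
  "mark2 n p \<pi> \<longleftrightarrow> (\<exists>s t. occ2 n \<pi> s t \<and> \<pi> s = p + 1)"

text \<open>
  Every entry in front of the occurrence exceeds \<open>\<pi> t\<close> and no other entry does, so these entries
  are the \<open>p\<close> largest values. Hence \<open>p\<close> determines \<open>t\<close>.
\<close>
lemma occ1_image:
  assumes \<pi>: "\<pi> permutes {1..n}" and occ: "occ1 n \<pi> (p + 1) t"
  shows "\<pi> ` {1..p} = {\<pi> t + 1..n}" and "\<pi> t = n - p"
proof -
  have p: "p + 1 < t" "t \<le> n" using occ by (auto simp: occ1_def)
  have big: "\<pi> t < \<pi> i \<longleftrightarrow> i \<le> p" if "i \<in> {1..n}" for i
  proof -
    have *: "i \<le> p \<Longrightarrow> \<pi> t < \<pi> i" "p + 1 < i \<Longrightarrow> i < t \<Longrightarrow> \<pi> i < \<pi> t"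
      "t < i \<Longrightarrow> \<pi> i < \<pi> (p + 1)" "\<pi> (p + 1) < \<pi> t"
      using occ that by (auto simp: occ1_def)
    consider "i \<le> p" | "i = p + 1" | "p + 1 < i" "i < t" | "i = t" | "t < i" by linarith
    then show ?thesis using * p by cases simp_all
  qed
  show img: "\<pi> ` {1..p} = {\<pi> t + 1..n}"
  proof (intro set_eqI iffI)
    fix v assume "v \<in> {\<pi> t + 1..n}"
    then have "v \<in> \<pi> ` {1..n}" by (simp add: permutes_image[OF \<pi>])
    then obtain i where i: "i \<in> {1..n}" "v = \<pi> i" by blast
    with big[of i] \<open>v \<in> {\<pi> t + 1..n}\<close> have "i \<in> {1..p}" by simp
    with i show "v \<in> \<pi> ` {1..p}" by blast
  qed (use big p permutes_range[OF \<pi>] in \<open>fastforce\<close>)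
  have "card (\<pi> ` {1..p}) = p"
    by (simp add: card_image inj_on_subset[OF permutes_inj[OF \<pi>]])
  moreover have "\<pi> t \<le> n" using permutes_range[OF \<pi>, of t] p by simp
  ultimately show "\<pi> t = n - p" using img by simp
qed

text \<open>
  The entries strictly between \<open>s\<close> and \<open>t\<close> are below \<open>\<pi> s\<close> and no other entry is, so there are
  \<open>p\<close> of them, which determines \<open>t\<close>.
\<close>
lemma occ2_image:
  assumes \<pi>: "\<pi> permutes {1..n}" and occ: "occ2 n \<pi> s t" and "\<pi> s = p + 1"
  shows "\<pi> ` {s + 1..s + p} = {1..p}" and "t = s + p + 1"
proof -
  have st: "1 \<le> s" "s < t" "t \<le> n" using occ by (auto simp: occ2_def)
  have small: "\<pi> i \<le> p \<longleftrightarrow> s < i \<and> i < t" if "i \<in> {1..n}" for i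
  proof -
    have *: "i < s \<Longrightarrow> \<pi> t < \<pi> i" "s < i \<Longrightarrow> i < t \<Longrightarrow> \<pi> i < \<pi> s"
      "t < i \<Longrightarrow> \<pi> s < \<pi> i" "\<pi> s < \<pi> t"
      using occ that by (auto simp: occ2_def)
    consider "i < s" | "i = s" | "s < i" "i < t" | "i = t" | "t < i" by linarith
    then show ?thesis using * st \<open>\<pi> s = p + 1\<close> by cases simp_all
  qed
  have "p \<le> n" using permutes_range[OF \<pi>, of s] st \<open>\<pi> s = p + 1\<close> by simp
  have img: "\<pi> ` {s + 1..<t} = {1..p}"
  proof (intro set_eqI iffI)
    fix v assume "v \<in> {1..p}"
    moreover from this have "v \<in> \<pi> ` {1..n}" using \<open>p \<le> n\<close> by (simp add: permutes_image[OF \<pi>])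
    ultimately show "v \<in> \<pi> ` {s + 1..<t}" using small by auto
  qed (use small st permutes_range[OF \<pi>] in \<open>fastforce\<close>)
  have "card (\<pi> ` {s + 1..<t}) = t - (s + 1)"
    by (simp add: card_image inj_on_subset[OF permutes_inj[OF \<pi>]])
  with img st show "t = s + p + 1" by simp
  then have "{s + 1..s + p} = {s + 1..<t}" by auto
  with img show "\<pi> ` {s + 1..s + p} = {1..p}" by simp
qed

lemma mesh12_count_eq_card_mark1:
  assumes "\<pi> permutes {1..n}"
  shows "mesh12_count {(0, 0), (0, 1), (1, 2), (2, 1), (2, 2)} n \<pi> = card (marks mark1 n \<pi>)"
proof -
  let ?O = "{(s, t). occ1 n \<pi> s t}"
  have "s = s' \<and> t = t'" if "occ1 n \<pi> s t" "occ1 n \<pi> s' t'" "s - 1 = s' - 1" for s t s' t'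
  proof -
    define p where "p = s - 1"
    from that have s: "s = p + 1" "s' = p + 1"
      by (auto simp: occ1_def p_def)
    with that have "occ1 n \<pi> (p + 1) t" "occ1 n \<pi> (p + 1) t'"
      by simp_all
    then have "\<pi> t = n - p" "\<pi> t' = n - p"
      using occ1_image(2)[OF assms] by blast+
    then have "t = t'" using permutes_inj[OF assms] by (metis inj_eq)
    with s show ?thesis by simp
  qed
  then have "inj_on (\<lambda>(s, t). s - 1) ?O"
    by (auto intro!: inj_onI)
  then have "card ?O = card ((\<lambda>(s, t). s - 1) ` ?O)"
    by (rule card_image[symmetric])
  also have "(\<lambda>(s, t). s - 1) ` ?O = marks mark1 n \<pi>"
  proof (intro set_eqI iffI)
    fix p assume "p \<in> (\<lambda>(s, t). s - 1) ` ?O"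
    then obtain s t where occ: "occ1 n \<pi> s t" and p: "p = s - 1" by auto
    then have "s = p + 1" and "p < n" by (auto simp: occ1_def)
    from occ this(1) have "occ1 n \<pi> (p + 1) t" by (rule back_subst[of "\<lambda>s. occ1 n \<pi> s t"])
    with \<open>p < n\<close> show "p \<in> marks mark1 n \<pi>" unfolding marks_def mark1_def by blast
  next
    fix p assume "p \<in> marks mark1 n \<pi>"
    then obtain t where "occ1 n \<pi> (p + 1) t" unfolding marks_def mark1_def by blast
    then show "p \<in> (\<lambda>(s, t). s - 1) ` ?O"
      by (intro image_eqI[of _ _ "(p + 1, t)"]) auto
  qed
  finally show ?thesis
    unfolding mesh12_count_def mesh12_occurrence_iff_occ1[OF assms] .
qed

lemma mesh12_count_eq_card_mark2:
  assumes "\<pi> permutes {1..n}"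
  shows "mesh12_count {(0, 0), (0, 1), (1, 1), (1, 2), (2, 0)} n \<pi> = card (marks mark2 n \<pi>)"
proof -
  let ?O = "{(s, t). occ2 n \<pi> s t}"
  have pos: "1 \<le> \<pi> s" "\<pi> s \<le> n" if "occ2 n \<pi> s t" for s t
    using that permutes_range[OF assms, of s] by (auto simp: occ2_def)
  have "s = s' \<and> t = t'"
    if occ: "occ2 n \<pi> s t" "occ2 n \<pi> s' t'" and "\<pi> s - 1 = \<pi> s' - 1" for s t s' t'
  proof -
    define p where "p = \<pi> s - 1"
    have p: "\<pi> s = p + 1" "\<pi> s' = p + 1"
      using pos(1)[OF occ(1)] pos(1)[OF occ(2)] that(3) by (auto simp: p_def)
    then have "s = s'" using permutes_inj[OF assms] by (metis inj_eq)
    moreover have "t = s + p + 1" "t' = s' + p + 1"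
      using occ2_image(2)[OF assms] occ p by blast+
    ultimately show ?thesis by simp
  qed
  then have "inj_on (\<lambda>(s, t). \<pi> s - 1) ?O"
    by (auto intro!: inj_onI)
  then have "card ?O = card ((\<lambda>(s, t). \<pi> s - 1) ` ?O)"
    by (rule card_image[symmetric])
  also have "(\<lambda>(s, t). \<pi> s - 1) ` ?O = marks mark2 n \<pi>"
  proof (intro set_eqI iffI)
    fix p assume "p \<in> (\<lambda>(s, t). \<pi> s - 1) ` ?O"
    then obtain s t where occ: "occ2 n \<pi> s t" and p: "p = \<pi> s - 1" by auto
    have "p < n" "\<pi> s = p + 1" using pos[OF occ] p by auto
    with occ show "p \<in> marks mark2 n \<pi>" unfolding marks_def mark2_def by blast
  next
    fix p assume "p \<in> marks mark2 n \<pi>"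
    then obtain s t where "occ2 n \<pi> s t" "\<pi> s = p + 1" unfolding marks_def mark2_def by blast
    then show "p \<in> (\<lambda>(s, t). \<pi> s - 1) ` ?O"
      by (intro image_eqI[of _ _ "(s, t)"]) auto
  qed
  finally show ?thesis
    unfolding mesh12_count_def mesh12_occurrence_iff_occ2[OF assms] .
qed

text \<open>
  The entries of \<open>\<mu>\<close> come first and are larger than all entries of \<open>\<delta>\<close>. This is what an occurrence
  starting in \<open>\<delta>\<close> demands of the entries in front of it. An occurrence that starts in \<open>\<mu>\<close> cannot
  end in \<open>\<delta>\<close>, where the values are smaller, and the entries of \<open>\<delta>\<close> satisfy its demand on the
  entries behind it.
\<close>
lemma mark1_skew_sum:
  assumes \<delta>: "\<delta> permutes {1..m}" and \<mu>: "\<mu> permutes {1..p}"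
  defines "\<pi> \<equiv> plug 0 m p \<delta> \<mu>"
  shows "mark1 (m + p) p \<pi> \<longleftrightarrow> mark1 m 0 \<delta>"
    and "q < p \<Longrightarrow> mark1 (m + p) q \<pi> \<longleftrightarrow> mark1 p q \<mu>"
proof -
  have upper: "\<pi> i = m + \<mu> i" if "1 \<le> i" "i \<le> p" for i
    using plug_block[of i p 0 m \<delta> \<mu>] that by (simp add: \<pi>_def)
  have lower: "\<pi> (i + p) = \<delta> i" "\<pi> (i + p) \<le> m" if "1 \<le> i" "i \<le> m" for i
    using plug_skip[of 0 m p \<delta> \<mu> i] that permutes_range(2)[OF \<delta>, of i]
    by (simp_all add: \<pi>_def skip_def)
  have lower': "\<pi> i \<le> m" if "p < i" "i \<le> m + p" for i
    using lower(2)[of "i - p"] that by simp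
  have large: "m < \<pi> i" if "1 \<le> i" "i \<le> p" for i
    using upper[OF that] permutes_range(1)[OF \<mu> that] by simp
  have "occ1 (m + p) \<pi> (p + 1) (t + p) \<longleftrightarrow> occ1 m \<delta> (0 + 1) t" for t
  proof
    assume occ: "occ1 (m + p) \<pi> (p + 1) (t + p)"
    then have t: "1 < t" "t \<le> m" by (auto simp: occ1_def)
    have "\<delta> i < \<delta> t" if "1 < i" "i < t" for i
    proof -
      have "\<pi> (i + p) < \<pi> (t + p)" using occ that by (simp add: occ1_def)
      then show ?thesis using lower(1) that t by simp
    qed
    moreover have "\<delta> i < \<delta> 1" if "t < i" "i \<le> m" for i
    proof -
      have "\<pi> (i + p) < \<pi> (p + 1)" using occ that by (simp add: occ1_def)
      then show ?thesis using lower(1)[of i] lower(1)[of 1] that t by (simp add: add.commute)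
    qed
    moreover have "\<delta> 1 < \<delta> t"
      using occ lower(1)[of t] lower(1)[of 1] t by (simp add: occ1_def add.commute)
    ultimately show "occ1 m \<delta> (0 + 1) t" using t by (simp add: occ1_def)
  next
    assume occ: "occ1 m \<delta> (0 + 1) t"
    then have t: "1 < t" "t \<le> m" by (auto simp: occ1_def)
    have "\<pi> (t + p) < \<pi> i" if "1 \<le> i" "i < p + 1" for i
      using large[of i] lower(2)[of t] that t by simp
    moreover have "\<pi> i < \<pi> (t + p)" if "p + 1 < i" "i < t + p" for i
    proof -
      have "1 < i - p" "i - p < t" using that by linarith+
      then have "\<delta> (i - p) < \<delta> t" using occ by (simp add: occ1_def)
      then show ?thesis using lower(1)[of "i - p"] lower(1)[of t] that t by simp
    qed
    moreover have "\<pi> i < \<pi> (p + 1)" if "t + p < i" "i \<le> m + p" for i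
    proof -
      have "t < i - p" "i - p \<le> m" using that by linarith+
      then have "\<delta> (i - p) < \<delta> 1" using occ by (simp add: occ1_def)
      then show ?thesis using lower(1)[of "i - p"] lower(1)[of 1] that t by (simp add: add.commute)
    qed
    moreover have "\<pi> (p + 1) < \<pi> (t + p)"
      using occ lower(1)[of t] lower(1)[of 1] t by (simp add: occ1_def add.commute)
    ultimately show "occ1 (m + p) \<pi> (p + 1) (t + p)" using t by (simp add: occ1_def)
  qed
  moreover have "p \<le> t" if "occ1 (m + p) \<pi> (p + 1) t" for t
    using that by (simp add: occ1_def)
  ultimately show "mark1 (m + p) p \<pi> \<longleftrightarrow> mark1 m 0 \<delta>"
    unfolding mark1_def by (metis le_add_diff_inverse2)
  have "occ1 (m + p) \<pi> (q + 1) t \<longleftrightarrow> occ1 p \<mu> (q + 1) t" if q: "q < p" for t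
  proof (cases "t \<le> p")
    case False
    have "\<not> \<pi> (q + 1) < \<pi> t" if "t \<le> m + p"
      using large[of "q + 1"] lower'[of t] q False that by simp
    with False show ?thesis by (auto simp: occ1_def)
  next
    case t: True
    show ?thesis
    proof
      assume occ: "occ1 (m + p) \<pi> (q + 1) t"
      have "\<mu> t < \<mu> i" if "1 \<le> i" "i < q + 1" for i
      proof -
        have "\<pi> t < \<pi> i" using occ that by (simp add: occ1_def)
        then show ?thesis using upper[of t] upper[of i] that t q occ by (simp add: occ1_def)
      qed
      moreover have "\<mu> i < \<mu> t" if "q + 1 < i" "i < t" for i
      proof -
        have "\<pi> i < \<pi> t" using occ that by (simp add: occ1_def)
        then show ?thesis using upper[of t] upper[of i] that t by simp
      qed
      moreover have "\<mu> i < \<mu> (q + 1)" if "t < i" "i \<le> p" for i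
      proof -
        have "\<pi> i < \<pi> (q + 1)" using occ that by (simp add: occ1_def)
        then show ?thesis using upper[of "q + 1"] upper[of i] that t q by simp
      qed
      moreover have "\<mu> (q + 1) < \<mu> t"
        using occ upper[of "q + 1"] upper[of t] t q by (simp add: occ1_def)
      ultimately show "occ1 p \<mu> (q + 1) t" using occ t by (simp add: occ1_def)
    next
      assume occ: "occ1 p \<mu> (q + 1) t"
      have "\<pi> t < \<pi> i" if "1 \<le> i" "i < q + 1" for i
      proof -
        have "\<mu> t < \<mu> i" using occ that by (simp add: occ1_def)
        then show ?thesis using upper[of t] upper[of i] that t q occ by (simp add: occ1_def)
      qed
      moreover have "\<pi> i < \<pi> t" if "q + 1 < i" "i < t" for i
      proof -
        have "\<mu> i < \<mu> t" using occ that by (simp add: occ1_def)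
        then show ?thesis using upper[of t] upper[of i] that t by simp
      qed
      moreover have "\<pi> i < \<pi> (q + 1)" if "t < i" "i \<le> m + p" for i
      proof (cases "i \<le> p")
        case True
        then have "\<mu> i < \<mu> (q + 1)" using occ that by (simp add: occ1_def)
        then show ?thesis using upper[of "q + 1"] upper[of i] that True q by simp
      next
        case False
        then show ?thesis using large[of "q + 1"] lower'[of i] that q by simp
      qed
      moreover have "\<pi> (q + 1) < \<pi> t"
        using occ upper[of "q + 1"] upper[of t] t q by (simp add: occ1_def)
      ultimately show "occ1 (m + p) \<pi> (q + 1) t" using occ t by (simp add: occ1_def)
    qed
  qed
  then show "q < p \<Longrightarrow> mark1 (m + p) q \<pi> \<longleftrightarrow> mark1 p q \<mu>"
    unfolding mark1_def by blast
qed

lemma mark2_iff: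
  assumes "\<pi> permutes {1..n}" "\<pi> s = p + 1"
  shows "mark2 n p \<pi> \<longleftrightarrow> occ2 n \<pi> s (s + p + 1)"
proof
  assume "mark2 n p \<pi>"
  then obtain s' t where occ: "occ2 n \<pi> s' t" and s': "\<pi> s' = p + 1" by (auto simp: mark2_def)
  from s' assms have "s' = s" using permutes_inj[OF assms(1)] by (metis inj_eq)
  with occ occ2_image(2)[OF assms(1) occ s'] show "occ2 n \<pi> s (s + p + 1)" by simp
next
  assume "occ2 n \<pi> s (s + p + 1)"
  with assms(2) show "mark2 n p \<pi>" unfolding mark2_def by blast
qed

text \<open>
  The block of \<open>\<mu>\<close> follows the image of the value 1 of \<open>\<delta>\<close> and takes all the smaller values, which is
  what the entries strictly between \<open>s\<close> and \<open>t\<close> have to do. An occurrence that starts in the block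
  has position \<open>s\<close> on its left. The entry there is \<open>p + 1\<close> and must exceed the upper entry of the
  occurrence, which therefore lies in the block as well. The entries outside the block are larger
  than those inside, as such an occurrence demands both on its left and on its right.
\<close>
lemma mark2_plug_after_1:
  assumes \<delta>: "\<delta> permutes {1..m}" and \<mu>: "\<mu> permutes {1..p}" and s: "1 \<le> s" "s \<le> m" "\<delta> s = 1"
  defines "\<pi> \<equiv> plug s 0 p \<delta> \<mu>"
  shows "mark2 (m + p) p \<pi> \<longleftrightarrow> mark2 m 0 \<delta>"
    and "q < p \<Longrightarrow> mark2 (m + p) q \<pi> \<longleftrightarrow> mark2 p q \<mu>"
proof -
  have \<pi>: "\<pi> permutes {1..m + p}"
    unfolding \<pi>_def by (rule plug_permutes[OF \<delta> \<mu>]) (use s in simp_all)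
  have block: "\<pi> (s + i) = \<mu> i" "1 \<le> \<pi> (s + i)" "\<pi> (s + i) \<le> p" if "1 \<le> i" "i \<le> p" for i
    using plug_block[of i p s 0 \<delta> \<mu>] permutes_range[OF \<mu>, of i] that by (simp_all add: \<pi>_def)
  have left: "\<pi> i = \<delta> i + p" "p < \<pi> i" if "1 \<le> i" "i \<le> s" for i
    using plug_skip[of s 0 p \<delta> \<mu> i] permutes_range(1)[OF \<delta>, of i] that s
    by (simp_all add: \<pi>_def skip_def)
  have right: "\<pi> (i + p) = \<delta> i + p" if "s < i" "i \<le> m" for i
    using plug_skip[of s 0 p \<delta> \<mu> i] permutes_range(1)[OF \<delta>, of i] that
    by (simp add: \<pi>_def skip_def)
  have one: "1 < \<delta> i" if "1 \<le> i" "i \<le> m" "i \<noteq> s" for i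
    using permutes_range(1)[OF \<delta> that(1,2)] permutes_inj[OF \<delta>] s(3) that(3)
    by (metis inj_eq le_neq_implies_less)
  have right': "p + 1 < \<pi> i" if "s + p < i" "i \<le> m + p" for i
    using right[of "i - p"] one[of "i - p"] that by simp
  have \<pi>s: "\<pi> s = p + 1" using left(1)[of s] s by simp
  have "occ2 (m + p) \<pi> s (s + p + 1) \<longleftrightarrow> occ2 m \<delta> s (s + 0 + 1)"
  proof
    assume occ: "occ2 (m + p) \<pi> s (s + p + 1)"
    then have m: "s + 1 \<le> m" by (simp add: occ2_def)
    have "\<delta> (s + 1) < \<delta> i" if "1 \<le> i" "i < s" for i
    proof -
      have "\<pi> (s + 1 + p) < \<pi> i" using occ that by (simp add: occ2_def add_ac)
      then show ?thesis using left[of i] right[of "s + 1"] that m by simp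
    qed
    with one s m show "occ2 m \<delta> s (s + 0 + 1)" by (simp add: occ2_def)
  next
    assume occ: "occ2 m \<delta> s (s + 0 + 1)"
    then have m: "s + 1 \<le> m" by (simp add: occ2_def)
    have "\<pi> (s + p + 1) < \<pi> i" if "1 \<le> i" "i < s" for i
    proof -
      have "\<delta> (s + 1) < \<delta> i" using occ that by (simp add: occ2_def)
      then show ?thesis using left[of i] right[of "s + 1"] that m by (simp add: add_ac)
    qed
    moreover have "\<pi> i < p + 1" if "s < i" "i < s + p + 1" for i
    proof -
      have "1 \<le> i - s" "i - s \<le> p" using that by linarith+
      then show ?thesis using block(3)[of "i - s"] that by simp
    qed
    ultimately show "occ2 (m + p) \<pi> s (s + p + 1)"
      using right' s m unfolding occ2_def \<pi>s by simp
  qed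
  moreover have "\<delta> s = 0 + 1" using s by simp
  ultimately show "mark2 (m + p) p \<pi> \<longleftrightarrow> mark2 m 0 \<delta>"
    using mark2_iff[OF \<pi> \<pi>s] mark2_iff[OF \<delta>, of s 0] by simp
  show "mark2 (m + p) q \<pi> \<longleftrightarrow> mark2 p q \<mu>" if q: "q < p"
  proof -
    define r where "r = inv \<mu> (q + 1)"
    have \<mu>r: "\<mu> r = q + 1" using permutes_inverses(1)[OF \<mu>] by (simp add: r_def)
    then have r: "1 \<le> r" "r \<le> p"
      using q permutes_in_image[OF \<mu>, of r] by auto
    have \<pi>r: "\<pi> (s + r) = q + 1" using block(1)[of r] r \<mu>r by simp
    have "occ2 (m + p) \<pi> (s + r) (s + r + q + 1) \<longleftrightarrow> occ2 p \<mu> r (r + q + 1)"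
    proof
      assume occ: "occ2 (m + p) \<pi> (s + r) (s + r + q + 1)"
      then have le: "s + r + q + 1 \<le> m + p" by (simp add: occ2_def)
      have "\<pi> (s + r + q + 1) < \<pi> s" using occ s r by (simp add: occ2_def)
      then have t: "r + q + 1 \<le> p"
        using right'[of "s + r + q + 1"] le \<pi>s by (cases "r + q + 1 \<le> p") auto
      then have \<pi>t: "\<pi> (s + r + q + 1) = \<mu> (r + q + 1)"
        using block(1)[of "r + q + 1"] by (simp add: add_ac)
      have "\<mu> (r + q + 1) < \<mu> i" if "1 \<le> i" "i < r" for i
      proof -
        have "\<pi> (s + r + q + 1) < \<pi> (s + i)" using occ that by (simp add: occ2_def)
        then show ?thesis using block(1)[of i] that r \<pi>t by simp
      qed
      moreover have "\<mu> i < q + 1" if "r < i" "i < r + q + 1" for i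
      proof -
        have "\<pi> (s + i) < \<pi> (s + r)" using occ that by (simp add: occ2_def)
        then show ?thesis using block(1)[of i] that t \<pi>r by simp
      qed
      moreover have "q + 1 < \<mu> i" if "r + q + 1 < i" "i \<le> p" for i
      proof -
        have "\<pi> (s + r) < \<pi> (s + i)" using occ that s by (simp add: occ2_def)
        then show ?thesis using block(1)[of i] that \<pi>r by simp
      qed
      moreover have "q + 1 < \<mu> (r + q + 1)"
        using occ \<pi>t \<pi>r by (simp add: occ2_def)
      ultimately show "occ2 p \<mu> r (r + q + 1)"
        using r t unfolding occ2_def \<mu>r by simp
    next
      assume occ: "occ2 p \<mu> r (r + q + 1)"
      then have t: "r + q + 1 \<le> p" by (simp add: occ2_def)
      then have \<pi>t: "\<pi> (s + r + q + 1) = \<mu> (r + q + 1)" "\<mu> (r + q + 1) \<le> p"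
        using block(1,3)[of "r + q + 1"] by (simp_all add: add_ac)
      have "\<mu> (r + q + 1) < \<pi> i" if "1 \<le> i" "i < s + r" for i
      proof (cases "i \<le> s")
        case True
        then show ?thesis using left(2)[of i] \<pi>t(2) that by simp
      next
        case False
        then have "1 \<le> i - s" "i - s < r" using that by linarith+
        then have "\<mu> (r + q + 1) < \<mu> (i - s)" using occ by (simp add: occ2_def)
        then show ?thesis using block(1)[of "i - s"] that False r by simp
      qed
      moreover have "\<pi> i < q + 1" if "s + r < i" "i < s + r + q + 1" for i
      proof -
        have "r < i - s" "i - s < r + q + 1" using that by linarith+
        then have "\<mu> (i - s) < \<mu> r" using occ by (simp add: occ2_def)
        then show ?thesis using block(1)[of "i - s"] that t \<mu>r by simp
      qed
      moreover have "q + 1 < \<pi> i" if "s + r + q + 1 < i" "i \<le> m + p" for i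
      proof (cases "i \<le> s + p")
        case True
        then have "r + q + 1 < i - s" "i - s \<le> p" using that by linarith+
        then have "\<mu> r < \<mu> (i - s)" using occ by (simp add: occ2_def)
        then show ?thesis using block(1)[of "i - s"] that True \<mu>r by simp
      next
        case False
        then show ?thesis using right'[of i] that q by simp
      qed
      moreover have "q + 1 < \<mu> (r + q + 1)"
        using occ \<mu>r by (simp add: occ2_def)
      ultimately show "occ2 (m + p) \<pi> (s + r) (s + r + q + 1)"
        using s r t unfolding occ2_def \<pi>r \<pi>t(1) by simp
    qed
    then show ?thesis using mark2_iff[OF \<pi> \<pi>r] mark2_iff[OF \<mu> \<mu>r] by simp
  qed
qed

lemma nested_marking_mark1: "nested_marking mark1 (\<lambda>m p. plug 0 m p)"
proof
  fix m p
  let ?g = "\<lambda>(\<delta>, \<mu>). plug 0 m p \<delta> \<mu>"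
  let ?A = "{\<delta> \<in> perms m. mark1 m 0 \<delta>} \<times> perms p"
  let ?B = "{\<pi> \<in> perms (m + p). mark1 (m + p) p \<pi>}"
  have "inj_on ?g ?A"
  proof (rule inj_onI)
    fix x y assume "x \<in> ?A" "y \<in> ?A" "?g x = ?g y"
    then show "x = y"
      using plug_inject[of 0 m p "fst x" "snd x" "fst y" "snd y"]
      by (simp add: mem_Times_iff case_prod_beta prod_eq_iff)
  qed
  moreover have "?g ` ?A = ?B"
  proof (intro equalityI subsetI)
    fix \<pi> assume "\<pi> \<in> ?g ` ?A"
    then obtain \<delta> \<mu> where "\<delta> permutes {1..m}" "mark1 m 0 \<delta>" "\<mu> permutes {1..p}" "\<pi> = plug 0 m p \<delta> \<mu>"
      by auto
    then show "\<pi> \<in> ?B"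
      using plug_permutes[of \<delta> m \<mu> p 0 m] mark1_skew_sum(1)[of \<delta> m \<mu> p] by simp
  next
    fix \<pi> assume "\<pi> \<in> ?B"
    then obtain t where \<pi>: "\<pi> permutes {1..m + p}" and occ: "occ1 (m + p) \<pi> (p + 1) t"
      by (auto simp: mark1_def)
    have "\<pi> t = m" using occ1_image(2)[OF \<pi> occ] by simp
    then have "\<pi> ` {0 + 1..0 + p} = {m + 1..m + p}"
      using occ1_image(1)[OF \<pi> occ] by simp
    then obtain \<delta> \<mu> where "\<delta> permutes {1..m}" "\<mu> permutes {1..p}" "\<pi> = plug 0 m p \<delta> \<mu>"
      using plug_exists[OF \<pi> le0 order_refl] by blast
    moreover from this have "mark1 m 0 \<delta>"
      using \<open>\<pi> \<in> ?B\<close> mark1_skew_sum(1) by blast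
    ultimately show "\<pi> \<in> ?g ` ?A" by (intro image_eqI[of _ _ "(\<delta>, \<mu>)"]) simp_all
  qed
  ultimately show "bij_betw ?g ?A ?B"
    by (rule bij_betw_imageI)
qed (use mark1_skew_sum(2) in blast)

lemma mark2_0_inv:
  assumes "\<delta> permutes {1..m}" "mark2 m 0 \<delta>"
  shows "1 \<le> inv \<delta> 1" "inv \<delta> 1 \<le> m" "\<delta> (inv \<delta> 1) = 1"
proof -
  from assms(2) obtain s t where "1 \<le> s" "s < t" "t \<le> m" "\<delta> s = 1"
    by (auto simp: mark2_def occ2_def)
  moreover from this have "inv \<delta> 1 = s" using permutes_inverses(2)[OF assms(1)] by metis
  ultimately show "1 \<le> inv \<delta> 1" "inv \<delta> 1 \<le> m" "\<delta> (inv \<delta> 1) = 1" by simp_all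
qed

lemma plug_after_1_inv:
  assumes "\<delta> permutes {1..m}" "mark2 m 0 \<delta>" "\<mu> permutes {1..p}"
  shows "plug (inv \<delta> 1) 0 p \<delta> \<mu> (inv \<delta> 1) = p + 1"
  using plug_skip[of "inv \<delta> 1" 0 p \<delta> \<mu> "inv \<delta> 1"] mark2_0_inv[OF assms(1,2)]
  by (simp add: skip_def)

text \<open>
  The place where \<open>\<mu>\<close> is plugged in depends on \<open>\<delta>\<close>. It can be recovered from the result as the
  position of the value \<open>p + 1\<close>.
\<close>
lemma nested_marking_mark2: "nested_marking mark2 (\<lambda>m p \<delta>. plug (inv \<delta> 1) 0 p \<delta>)"
proof
  fix m p
  let ?g = "\<lambda>(\<delta>, \<mu>). plug (inv \<delta> 1) 0 p \<delta> \<mu>"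
  let ?A = "{\<delta> \<in> perms m. mark2 m 0 \<delta>} \<times> perms p"
  let ?B = "{\<pi> \<in> perms (m + p). mark2 (m + p) p \<pi>}"
  have perm: "plug (inv \<delta> 1) 0 p \<delta> \<mu> permutes {1..m + p}"
    if "\<delta> permutes {1..m}" "mark2 m 0 \<delta>" "\<mu> permutes {1..p}" for \<delta> \<mu>
    using plug_permutes[OF that(1,3)] mark2_0_inv[OF that(1,2)] by blast
  have inj: "\<delta> = \<delta>' \<and> \<mu> = \<mu>'"
    if "\<delta> permutes {1..m}" "mark2 m 0 \<delta>" "\<mu> permutes {1..p}"
      "\<delta>' permutes {1..m}" "mark2 m 0 \<delta>'" "\<mu>' permutes {1..p}"
      and eq: "plug (inv \<delta> 1) 0 p \<delta> \<mu> = plug (inv \<delta>' 1) 0 p \<delta>' \<mu>'" for \<delta> \<mu> \<delta>' \<mu>'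
  proof -
    have "inv \<delta> 1 = inv \<delta>' 1"
      using plug_after_1_inv[OF that(1-3)] plug_after_1_inv[OF that(4-6)]
        permutes_inj[OF perm[OF that(1-3)]] eq by (metis inj_eq)
    with eq have "plug (inv \<delta> 1) 0 p \<delta> \<mu> = plug (inv \<delta> 1) 0 p \<delta>' \<mu>'" by simp
    from plug_inject[OF this that(3,6)] show ?thesis by blast
  qed
  have "inj_on ?g ?A"
  proof (rule inj_onI)
    fix x y assume "x \<in> ?A" "y \<in> ?A" "?g x = ?g y"
    then show "x = y"
      using inj[of "fst x" "snd x" "fst y" "snd y"]
      by (simp add: mem_Times_iff case_prod_beta prod_eq_iff)
  qed
  moreover have "?g ` ?A = ?B"
  proof (intro equalityI subsetI)
    fix \<pi> assume "\<pi> \<in> ?g ` ?A"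
    then obtain \<delta> \<mu> where *: "\<delta> permutes {1..m}" "mark2 m 0 \<delta>" "\<mu> permutes {1..p}"
      and "\<pi> = plug (inv \<delta> 1) 0 p \<delta> \<mu>"
      by auto
    then show "\<pi> \<in> ?B"
      using perm[OF *] mark2_plug_after_1(1)[OF *(1,3) mark2_0_inv[OF *(1,2)]] by simp
  next
    fix \<pi> assume "\<pi> \<in> ?B"
    then obtain s t where \<pi>: "\<pi> permutes {1..m + p}" and occ: "occ2 (m + p) \<pi> s t"
      and \<pi>s: "\<pi> s = p + 1"
      by (auto simp: mark2_def)
    have s: "1 \<le> s" "s \<le> m" using occ occ2_image(2)[OF \<pi> occ \<pi>s] by (auto simp: occ2_def)
    have "\<pi> ` {s + 1..s + p} = {0 + 1..0 + p}"
      using occ2_image(1)[OF \<pi> occ \<pi>s] by simp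
    then obtain \<delta> \<mu> where \<delta>: "\<delta> permutes {1..m}" and \<mu>: "\<mu> permutes {1..p}"
      and plug: "\<pi> = plug s 0 p \<delta> \<mu>"
      using plug_exists[OF \<pi> s(2) le0] by blast
    have "skip 0 p (\<delta> s) = p + 1" using plug_skip[of s 0 p \<delta> \<mu> s] \<pi>s plug by (simp add: skip_def)
    then have "\<delta> s = 1" using permutes_range(1)[OF \<delta> s] by (simp add: skip_def split: if_splits)
    moreover from this have "inv \<delta> 1 = s" using permutes_inverses(2)[OF \<delta>] by metis
    moreover have "mark2 m 0 \<delta>"
      using \<open>\<pi> \<in> ?B\<close> mark2_plug_after_1(1)[OF \<delta> \<mu> s \<open>\<delta> s = 1\<close>] plug by blast
    ultimately show "\<pi> \<in> ?g ` ?A"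
      using \<delta> \<mu> plug by (intro image_eqI[of _ _ "(\<delta>, \<mu>)"]) simp_all
  qed
  ultimately show "bij_betw ?g ?A ?B"
    by (rule bij_betw_imageI)
next
  fix \<delta> \<mu> m p q
  assume "\<delta> \<in> perms m" "mark2 m 0 \<delta>" "\<mu> \<in> perms p" "q < p"
  then show "mark2 (m + p) q (plug (inv \<delta> 1) 0 p \<delta> \<mu>) \<longleftrightarrow> mark2 p q \<mu>"
    using mark2_plug_after_1(2)[of \<delta> m \<mu> p "inv \<delta> 1" q] mark2_0_inv[of \<delta> m] by simp
qed

section \<open>The two families of base permutations are equinumerous\<close>

definition flip :: "nat \<Rightarrow> nat \<Rightarrow> nat" where
  "flip m i = (if i \<in> {1..m} then m + 1 - i else i)"

lemma flip_flip [simp]: "flip m (flip m i) = i"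
  by (auto simp: flip_def)

lemma flip_permutes: "flip m permutes {1..m}"
proof -
  have "inj (flip m)" by (rule injI) (metis flip_flip)
  then show ?thesis by (simp add: permutes_interval_iff flip_def)
qed

text \<open>
  The order in which the positions of \<open>\<delta> = a M z R\<close>, with \<open>z\<close> the maximum, are read: backwards through \<open>R\<close> and the
  maximum, which takes \<open>s\<close> steps, then the first position, then backwards through \<open>M\<close>.
\<close>
definition reverse_moving_first :: "nat \<Rightarrow> nat \<Rightarrow> nat \<Rightarrow> nat" where
  "reverse_moving_first s m i = (if i \<notin> {1..m} then i else if i \<le> s then m + 1 - i
     else if i = s + 1 then 1 else m + 2 - i)"

lemma reverse_moving_first_permutes:
  assumes "1 \<le> s" "s < m"
  shows "reverse_moving_first s m permutes {1..m}"
  unfolding permutes_interval_iff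
proof (intro conjI allI impI injI)
  fix i j assume "reverse_moving_first s m i = reverse_moving_first s m j"
  then show "i = j"
    using assms unfolding reverse_moving_first_def by (simp split: if_splits) linarith+
qed (simp add: reverse_moving_first_def)

lemma mark1_0_iff:
  assumes "\<delta> permutes {1..m}"
  shows "mark1 m 0 \<delta> \<longleftrightarrow> (\<exists>t \<in> {2..m}. \<delta> t = m \<and> (\<forall>i \<in> {t + 1..m}. \<delta> i < \<delta> 1))"
proof
  assume "mark1 m 0 \<delta>"
  then obtain t where occ: "occ1 m \<delta> (0 + 1) t" by (auto simp: mark1_def)
  with occ1_image(2)[OF assms occ] show "\<exists>t \<in> {2..m}. \<delta> t = m \<and> (\<forall>i \<in> {t + 1..m}. \<delta> i < \<delta> 1)"
    by (intro bexI[of _ t]) (auto simp: occ1_def)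
next
  assume "\<exists>t \<in> {2..m}. \<delta> t = m \<and> (\<forall>i \<in> {t + 1..m}. \<delta> i < \<delta> 1)"
  then obtain t where t: "t \<in> {2..m}" "\<delta> t = m" "\<forall>i \<in> {t + 1..m}. \<delta> i < \<delta> 1" by blast
  have "\<delta> i < \<delta> t" if "i < t" for i
  proof -
    have "\<delta> i \<le> m" using permutes_range(2)[OF assms, of i] that t(1) by simp
    moreover have "\<delta> i \<noteq> \<delta> t" using permutes_inj[OF assms] that by (simp add: inj_eq)
    ultimately show ?thesis using t(2) by simp
  qed
  with t have "occ1 m \<delta> (0 + 1) t" by (simp add: occ1_def)
  then show "mark1 m 0 \<delta>" unfolding mark1_def by blast
qed

text \<open>
  The value 1 sits at position \<open>m + 1 - t\<close>, so that \<open>t\<close> matches the position of the maximum in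
  \<open>mark1_0_iff\<close> under reversal.
\<close>
lemma mark2_0_iff:
  assumes "\<delta> permutes {1..m}"
  shows "mark2 m 0 \<delta> \<longleftrightarrow>
    (\<exists>t \<in> {2..m}. \<delta> (m + 1 - t) = 1 \<and> (\<forall>i \<in> {1..<m + 1 - t}. \<delta> (m + 2 - t) < \<delta> i))"
proof
  assume "mark2 m 0 \<delta>"
  then obtain s t where occ: "occ2 m \<delta> s t" and s: "\<delta> s = 0 + 1" by (auto simp: mark2_def)
  have t: "t = s + 1" using occ2_image(2)[OF assms occ s] by simp
  have "s + 1 \<le> m" "1 \<le> s" using occ t by (auto simp: occ2_def)
  then have "m + 1 - s \<in> {2..m}" "m + 1 - (m + 1 - s) = s" "m + 2 - (m + 1 - s) = t" using t by auto
  then show "\<exists>t \<in> {2..m}. \<delta> (m + 1 - t) = 1 \<and> (\<forall>i \<in> {1..<m + 1 - t}. \<delta> (m + 2 - t) < \<delta> i)"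
    using s occ by (intro bexI[of _ "m + 1 - s"]) (simp_all add: occ2_def)
next
  assume "\<exists>t \<in> {2..m}. \<delta> (m + 1 - t) = 1 \<and> (\<forall>i \<in> {1..<m + 1 - t}. \<delta> (m + 2 - t) < \<delta> i)"
  then obtain t where t: "t \<in> {2..m}" "\<delta> (m + 1 - t) = 1"
    "\<forall>i \<in> {1..<m + 1 - t}. \<delta> (m + 2 - t) < \<delta> i" by blast
  define s where "s = m + 1 - t"
  have s: "1 \<le> s" "s + 1 \<le> m" "m + 2 - t = s + 1" using t(1) by (auto simp: s_def)
  have "\<delta> s < \<delta> i" if "1 \<le> i" "i \<le> m" "i \<noteq> s" for i
  proof -
    have "\<delta> i \<noteq> \<delta> s" using permutes_inj[OF assms] that by (simp add: inj_eq)
    then show ?thesis using permutes_range(1)[OF assms that(1,2)] t(2) by (simp add: s_def)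
  qed
  with t s have "occ2 m \<delta> s (s + 1)" by (simp add: occ2_def flip: s_def)
  moreover have "\<delta> s = 0 + 1" using t(2) by (simp add: s_def)
  ultimately show "mark2 m 0 \<delta>" unfolding mark2_def by blast
qed

text \<open>
  The bijection complements the values and reads the positions in the order
  \<open>reverse_moving_first\<close>. It sends the maximum at position \<open>t\<close> to the value 1 at position \<open>s\<close>, and
  the first entry to position \<open>s + 1\<close>. The entries behind the maximum become those in front of the 1.
\<close>
lemma card_base_at:
  assumes "t \<in> {2..m}"
  shows "card {\<delta> \<in> perms m. \<delta> t = m \<and> (\<forall>i \<in> {t + 1..m}. \<delta> i < \<delta> 1)}
    = card {\<delta> \<in> perms m. \<delta> (m + 1 - t) = 1 \<and> (\<forall>i \<in> {1..<m + 1 - t}. \<delta> (m + 2 - t) < \<delta> i)}"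
proof -
  define s where "s = m + 1 - t"
  have s: "1 \<le> s" "s < m" "m + 1 - s = t" "m + 2 - t = s + 1" using assms by (auto simp: s_def)
  let ?\<rho> = "reverse_moving_first s m"
  let ?f = "\<lambda>\<delta>. flip m \<circ> \<delta> \<circ> ?\<rho>"
  have \<rho>: "?\<rho> permutes {1..m}" using s by (intro reverse_moving_first_permutes) auto
  have "inj_on ?f (perms m)"
  proof (rule inj_onI)
    fix \<delta> \<delta>' assume "?f \<delta> = ?f \<delta>'"
    then have "flip m \<circ> ?f \<delta> \<circ> inv ?\<rho> = flip m \<circ> ?f \<delta>' \<circ> inv ?\<rho>" by simp
    then show "\<delta> = \<delta>'"
      using permutes_inverses(1)[OF \<rho>] by (simp add: fun_eq_iff)
  qed
  moreover have "?f ` perms m \<subseteq> perms m"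
    using flip_permutes \<rho> by (auto intro!: permutes_compose)
  ultimately have "bij_betw ?f (perms m) (perms m)"
    by (simp add: bij_betw_def endo_inj_surj)
  then have "bij_betw ?f {\<delta> \<in> perms m. \<delta> t = m \<and> (\<forall>i \<in> {t + 1..m}. \<delta> i < \<delta> 1)}
    {\<delta> \<in> perms m. \<delta> s = 1 \<and> (\<forall>i \<in> {1..<s}. \<delta> (s + 1) < \<delta> i)}"
  proof (rule bij_betw_Collect)
    fix \<delta> assume "\<delta> \<in> perms m"
    then have \<delta>: "\<delta> permutes {1..m}" by simp
    have f: "?f \<delta> i = m + 1 - \<delta> (?\<rho> i)" "1 \<le> \<delta> (?\<rho> i)" "\<delta> (?\<rho> i) \<le> m" if "i \<in> {1..m}" for i
      using that permutes_in_image[OF \<rho>, of i] permutes_in_image[OF \<delta>, of "?\<rho> i"]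
      by (auto simp: flip_def)
    have "?\<rho> s = t" "?\<rho> (s + 1) = 1" using s by (auto simp: reverse_moving_first_def)
    with f[of s] f[of "s + 1"] s have 1: "?f \<delta> s = 1 \<longleftrightarrow> \<delta> t = m"
      and 2: "?f \<delta> (s + 1) = m + 1 - \<delta> 1" "1 \<le> \<delta> 1" "\<delta> 1 \<le> m" by auto
    have 3: "?f \<delta> (s + 1) < ?f \<delta> i \<longleftrightarrow> \<delta> (m + 1 - i) < \<delta> 1" if "i \<in> {1..<s}" for i
    proof -
      have "?\<rho> i = m + 1 - i" using that s by (auto simp: reverse_moving_first_def)
      moreover have "i \<in> {1..m}" using that s by simp
      ultimately have i: "?f \<delta> i = m + 1 - \<delta> (m + 1 - i)" "\<delta> (m + 1 - i) \<le> m"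
        using f[of i] by simp_all
      show ?thesis unfolding i(1) 2(1) using 2(3) i(2) by arith
    qed
    have 4: "{t + 1..m} = (\<lambda>i. m + 1 - i) ` {1..<s}"
    proof (intro set_eqI iffI)
      fix i assume "i \<in> {t + 1..m}"
      then show "i \<in> (\<lambda>i. m + 1 - i) ` {1..<s}"
        by (intro image_eqI[of _ _ "m + 1 - i"]) (auto simp: s_def)
    qed (use s in auto)
    show "(?f \<delta> s = 1 \<and> (\<forall>i \<in> {1..<s}. ?f \<delta> (s + 1) < ?f \<delta> i))
      \<longleftrightarrow> (\<delta> t = m \<and> (\<forall>i \<in> {t + 1..m}. \<delta> i < \<delta> 1))"
      unfolding 1 4 using 3 by auto
  qed
  then show ?thesis
    unfolding s(4) s_def[symmetric] by (rule bij_betw_same_card)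
qed

lemma card_base_eq: "card {\<delta> \<in> perms m. mark1 m 0 \<delta>} = card {\<delta> \<in> perms m. mark2 m 0 \<delta>}"
proof -
  define X where "X t = {\<delta> \<in> perms m. \<delta> t = m \<and> (\<forall>i \<in> {t + 1..m}. \<delta> i < \<delta> 1)}" for t
  define Y where "Y t = {\<delta> \<in> perms m. \<delta> (m + 1 - t) = 1 \<and>
    (\<forall>i \<in> {1..<m + 1 - t}. \<delta> (m + 2 - t) < \<delta> i)}" for t
  have fin: "finite (X t)" "finite (Y t)" for t
    by (rule finite_subset[OF _ finite_perms[of m]], auto simp: X_def Y_def)+
  have inj: "i = j" if "\<delta> permutes {1..m}" "\<delta> i = \<delta> j" for \<delta> i j
    using permutes_inj[OF that(1)] that(2) by (rule injD)
  have X: "X t \<inter> X t' = {}" if "t \<noteq> t'" for t t'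
  proof (rule equals0I)
    fix \<delta> assume "\<delta> \<in> X t \<inter> X t'"
    then have "\<delta> permutes {1..m}" "\<delta> t = \<delta> t'" by (simp_all add: X_def)
    with that show False by (blast dest: inj)
  qed
  have Y: "Y t \<inter> Y t' = {}" if t: "t \<in> {2..m}" "t' \<in> {2..m}" "t \<noteq> t'" for t t'
  proof (rule equals0I)
    fix \<delta> assume "\<delta> \<in> Y t \<inter> Y t'"
    then have "\<delta> permutes {1..m}" "\<delta> (m + 1 - t) = \<delta> (m + 1 - t')" by (simp_all add: Y_def)
    then have "m + 1 - t = m + 1 - t'" by (rule inj)
    with t show False by auto
  qed
  have "{\<delta> \<in> perms m. mark1 m 0 \<delta>} = (\<Union>t \<in> {2..m}. X t)"
    using mark1_0_iff by (auto simp: X_def)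
  then have "card {\<delta> \<in> perms m. mark1 m 0 \<delta>} = (\<Sum>t \<in> {2..m}. card (X t))"
    using fin X by (simp add: card_UN_disjoint)
  also have "\<dots> = (\<Sum>t \<in> {2..m}. card (Y t))"
    unfolding X_def Y_def by (intro sum.cong card_base_at refl)
  also have "\<dots> = card (\<Union>t \<in> {2..m}. Y t)"
    using fin Y by (simp add: card_UN_disjoint)
  also have "(\<Union>t \<in> {2..m}. Y t) = {\<delta> \<in> perms m. mark2 m 0 \<delta>}"
    using mark2_0_iff by (auto simp: Y_def)
  finally show ?thesis .
qed

theorem theorem5p1:
  shows "mesh12_equidistributed
           {(0, 0), (0, 1), (1, 2), (2, 1), (2, 2)}
           {(0, 0), (0, 1), (1, 1), (1, 2), (2, 0)}"
proof -
  have "card {\<pi>. \<pi> permutes {1..n} \<and> mesh12_count {(0, 0), (0, 1), (1, 2), (2, 1), (2, 2)} n \<pi> = k}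
      = card {\<pi>. \<pi> permutes {1..n} \<and> mesh12_count {(0, 0), (0, 1), (1, 1), (1, 2), (2, 0)} n \<pi> = k}"
    for n k
  proof -
    have "{\<pi>. \<pi> permutes {1..n} \<and> mesh12_count {(0, 0), (0, 1), (1, 2), (2, 1), (2, 2)} n \<pi> = k}
        = {\<pi> \<in> perms n. card (marks mark1 n \<pi>) = k}"
      using mesh12_count_eq_card_mark1 by auto
    moreover have "{\<pi>. \<pi> permutes {1..n} \<and> mesh12_count {(0, 0), (0, 1), (1, 1), (1, 2), (2, 0)} n \<pi> = k}
        = {\<pi> \<in> perms n. card (marks mark2 n \<pi>) = k}"
      using mesh12_count_eq_card_mark2 by auto
    ultimately show ?thesis
      using nested_marking_equidistributed[OF nested_marking_mark1 nested_marking_mark2 card_base_eq]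
      by simp
  qed
  then show ?thesis
    unfolding mesh12_equidistributed_def by blast
qed

end
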